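(* Let $G=(V,E)$ be a connected finite simple graph with $n=|V|\ge 3$, and let $\vec x$ be an eigenvector of problem (M) corresponding to its largest eigenvalue. Then $S'(\vec x)\le\frac{n-1}{2}$, where $S'(\vec x)$ is the number of connected components of the subgraph induced by $D_+(\vec x)\cup D_-(\vec x)$.
   Context: $V=\{1,\dots,n\}$, unit edge weights, $\mathrm{vol}(V)=\sum_i d_i$. $\mathrm{Sgn}(t)=\{1\},[-1,1],\{-1\}$ for $t>0,t=0,t<0$; $(\Delta_1\vec x)_i=\{\sum_{j:\{i,j\}\in E}z_{ij}: z_{ij}\in\mathrm{Sgn}(x_i-x_j), z_{ij}=-z_{ji}\}$. Problem (M): $(\mu,\vec x)$ with $\vec x\ne\vec0$ and $\Delta_1\vec x\cap\mu\,\mathrm{vol}(V)\,\partial\|\vec x\|_\infty\ne\emptyset$. $D_\pm(\vec x)=\{i:\pm x_i=\|\vec x\|_\infty\}$. *)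

theory Defs
  imports "HOL-Analysis.Analysis" "Graph_Theory.Graph_Theory"
begin

text \<open>
  A finite simple graph is a loop-free symmetric digraph without parallel arcs (locale
  \<open>pair_graph\<close>): an edge \<open>{i, j}\<close> is the pair of arcs \<open>(i, j)\<close>, \<open>(j, i)\<close>. The vertex set is the
  whole index type \<open>'n\<close>, so that vectors on the vertices are elements of \<open>real ^ 'n\<close>.
\<close>

text \<open>Each edge at \<open>i\<close> contributes exactly one arc leaving \<open>i\<close>, so \<open>out_degree\<close> is \<open>d\<^sub>i\<close>.\<close>

definition vol :: "'n::finite pair_pre_digraph \<Rightarrow> real" where
  "vol G = (\<Sum>i\<in>pverts G. real (out_degree (with_proj G) i))"

definition Sgn :: "real \<Rightarrow> real set" where
  "Sgn t = (if t > 0 then {1} else if t = 0 then {-1..1} else {-1})"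

text \<open>A single antisymmetric family \<open>z\<close> serves all coordinates of an element of
  \<open>Laplacian1 G x\<close> simultaneously.\<close>

definition Laplacian1 :: "'n::finite pair_pre_digraph \<Rightarrow> real ^ 'n \<Rightarrow> (real ^ 'n) set" where
  "Laplacian1 G x =
     {(\<chi> i. \<Sum>j | (i, j) \<in> parcs G. z i j) | z.
        \<forall>(i, j) \<in> parcs G. z i j \<in> Sgn (x $ i - x $ j) \<and> z i j = - z j i}"

definition subdifferential :: "('a::real_inner \<Rightarrow> real) \<Rightarrow> 'a \<Rightarrow> 'a set" where
  "subdifferential f x = {u. \<forall>y. f y \<ge> f x + u \<bullet> (y - x)}"

definition eigenpair_M :: "'n::finite pair_pre_digraph \<Rightarrow> real \<Rightarrow> real ^ 'n \<Rightarrow> bool" where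
  "eigenpair_M G \<mu> x \<longleftrightarrow>
     x \<noteq> 0 \<and>
     Laplacian1 G x \<inter> (\<lambda>u. (\<mu> * vol G) *\<^sub>R u) ` subdifferential infnorm x \<noteq> {}"

definition D_plus :: "real ^ 'n::finite \<Rightarrow> 'n set" where
  "D_plus x = {i. x $ i = infnorm x}"

definition D_minus :: "real ^ 'n::finite \<Rightarrow> 'n set" where
  "D_minus x = {i. - (x $ i) = infnorm x}"

text \<open>In a symmetric digraph the strongly connected components are the connected components
  of the underlying undirected graph; induced subgraphs inherit symmetry.\<close>

definition S' :: "'n::finite pair_pre_digraph \<Rightarrow> real ^ 'n \<Rightarrow> nat" where
  "S' G x = card (pre_digraph.sccs (with_proj G \<restriction> (D_plus x \<union> D_minus x)))"

end

theory Submission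
  imports Defs
begin

text \<open>
  Pairing the eigenvalue inclusion with \<open>x\<close> gives \<open>TV x = \<mu> vol(V) \<parallel>x\<parallel>\<^sub>\<infinity>\<close>, where \<open>TV\<close> is the
  total variation, and a maximiser of \<open>TV\<close> on the cube is itself an eigenvector. Hence an
  eigenvector \<open>x\<close> of the largest eigenvalue maximises \<open>TV\<close> among vectors of its norm. The
  subgradient of the norm at \<open>x\<close> lives on \<open>D = D\<^sub>+ \<union> D\<^sub>-\<close>, so \<open>x\<close> stays a maximiser when its entries
  outside \<open>D\<close> are changed arbitrarily within the cube. If some \<open>i \<in> D\<close> had no neighbour in \<open>D\<close>, one
  could set all entries outside \<open>D\<close> to \<open>x\<^sub>i\<close> and then flip the sign of the \<open>i\<close>-th entry, which
  strictly increases \<open>TV\<close>. So every component of \<open>D\<close> has at least two vertices, which gives the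
  bound unless \<open>D = V\<close>, and then there is a single component.
\<close>

section \<open>Total variation and the 1-Laplacian\<close>

text \<open>Each edge is counted once for each of its two arcs, hence the division by 2.\<close>

definition TV :: "'n::finite pair_pre_digraph \<Rightarrow> real ^ 'n \<Rightarrow> real" where
  "TV G x = (\<Sum>(i, j)\<in>parcs G. \<bar>x $ i - x $ j\<bar>) / 2"

lemma TV_nonneg: "0 \<le> TV G x"
  unfolding TV_def by (intro divide_nonneg_nonneg sum_nonneg) auto

lemma TV_scaleR: "TV G (c *\<^sub>R x) = \<bar>c\<bar> * TV G x"
proof -
  have "\<bar>c * a - c * b\<bar> = \<bar>c\<bar> * \<bar>a - b\<bar>" for a b :: real
    by (simp add: abs_mult flip: right_diff_distrib)
  then show ?thesis
    by (simp add: TV_def sum_distrib_left case_prod_unfold)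
qed

lemma continuous_on_TV: "continuous_on S (TV G)"
  unfolding TV_def case_prod_unfold by (intro continuous_intros) auto

lemma sum_swap_arcs:
  assumes "sym E"
  shows "(\<Sum>(i, j)\<in>E. f i j) = (\<Sum>(i, j)\<in>E. f j i)"
  by (rule sum.reindex_bij_witness[where i = prod.swap and j = prod.swap])
    (use assms in \<open>auto dest: symD\<close>)

text \<open>Summation by parts: reversing all arcs and using antisymmetry of \<open>z\<close> merges
  the contributions at both ends of an edge.\<close>

lemma Laplacian1_inner_eq:
  fixes G :: "'n::finite pair_pre_digraph" and y :: "real ^ 'n"
  assumes "sym (parcs G)" "\<And>i j. (i, j) \<in> parcs G \<Longrightarrow> z i j = - z j i"
  shows "(\<chi> i. \<Sum>j | (i, j) \<in> parcs G. z i j) \<bullet> y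
           = (\<Sum>(i, j)\<in>parcs G. z i j * (y $ i - y $ j)) / 2"
proof -
  let ?E = "parcs G"
  have "(\<chi> i. \<Sum>j | (i, j) \<in> ?E. z i j) \<bullet> y = (\<Sum>i\<in>UNIV. \<Sum>j | (i, j) \<in> ?E. z i j * y $ i)"
    by (simp add: inner_vec_def sum_distrib_right)
  also have "\<dots> = (\<Sum>(i, j)\<in>(SIGMA i:UNIV. {j. (i, j) \<in> ?E}). z i j * y $ i)"
    by (rule sum.Sigma) auto
  also have "(SIGMA i:UNIV. {j. (i, j) \<in> ?E}) = ?E"
    by auto
  finally have 1: "(\<chi> i. \<Sum>j | (i, j) \<in> ?E. z i j) \<bullet> y = (\<Sum>(i, j)\<in>?E. z i j * y $ i)" .
  have "(\<Sum>(i, j)\<in>?E. z i j * y $ i) = (\<Sum>(i, j)\<in>?E. z j i * y $ j)"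
    by (rule sum_swap_arcs[OF assms(1)])
  also have "\<dots> = (\<Sum>(i, j)\<in>?E. - (z i j * y $ j))"
    by (rule sum.cong) (auto simp: assms(2))
  finally have "2 * (\<Sum>(i, j)\<in>?E. z i j * y $ i)
      = (\<Sum>(i, j)\<in>?E. z i j * y $ i) + (\<Sum>(i, j)\<in>?E. - (z i j * y $ j))"
    by simp
  also have "\<dots> = (\<Sum>(i, j)\<in>?E. z i j * (y $ i - y $ j))"
    by (simp add: case_prod_unfold algebra_simps flip: sum.distrib)
  finally show ?thesis
    using 1 by simp
qed

lemma Laplacian1_inner_self:
  assumes "sym (parcs G)" "u \<in> Laplacian1 G x"
  shows "u \<bullet> x = TV G x"
proof -
  obtain z where u: "u = (\<chi> i. \<Sum>j | (i, j) \<in> parcs G. z i j)"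
    and z: "\<And>i j. (i, j) \<in> parcs G \<Longrightarrow> z i j \<in> Sgn (x $ i - x $ j) \<and> z i j = - z j i"
    using assms(2) unfolding Laplacian1_def by blast
  have "z i j * (x $ i - x $ j) = \<bar>x $ i - x $ j\<bar>" if "(i, j) \<in> parcs G" for i j
    using z[OF that] by (auto simp: Sgn_def split: if_splits)
  then show ?thesis
    unfolding u TV_def using z by (subst Laplacian1_inner_eq[OF assms(1)]) (auto intro!: sum.cong)
qed

text \<open>Since \<open>z\<close> has modulus at most 1. With \<open>Laplacian1_inner_self\<close>,
  this makes \<open>u\<close> a subgradient of \<open>TV G\<close> at \<open>x\<close>.\<close>

lemma Laplacian1_inner_le:
  assumes "sym (parcs G)" "u \<in> Laplacian1 G x"
  shows "u \<bullet> y \<le> TV G y"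
proof -
  obtain z where u: "u = (\<chi> i. \<Sum>j | (i, j) \<in> parcs G. z i j)"
    and z: "\<And>i j. (i, j) \<in> parcs G \<Longrightarrow> z i j \<in> Sgn (x $ i - x $ j) \<and> z i j = - z j i"
    using assms(2) unfolding Laplacian1_def by blast
  have "z i j * (y $ i - y $ j) \<le> \<bar>y $ i - y $ j\<bar>" if "(i, j) \<in> parcs G" for i j
  proof -
    have "\<bar>z i j\<bar> \<le> 1"
      using z[OF that] by (auto simp: Sgn_def split: if_splits)
    then have "\<bar>z i j\<bar> * \<bar>y $ i - y $ j\<bar> \<le> 1 * \<bar>y $ i - y $ j\<bar>"
      by (rule mult_right_mono) simp
    then show ?thesis
      by (simp flip: abs_mult)
  qed
  then show ?thesis
    unfolding u TV_def using z
    by (subst Laplacian1_inner_eq[OF assms(1)]) (auto intro!: sum_mono divide_right_mono)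
qed

lemma Laplacian1_nonempty: "Laplacian1 G x \<noteq> {}"
proof -
  \<comment> \<open>\<open>sgn\<close> is an odd selection of \<open>Sgn\<close>, so it yields an
    antisymmetric family.\<close>
  have "(\<chi> i. \<Sum>j | (i, j) \<in> parcs G. sgn (x $ i - x $ j)) \<in> Laplacian1 G x"
    unfolding Laplacian1_def
    by (intro CollectI exI[of _ "\<lambda>i j. sgn (x $ i - x $ j)"])
      (auto simp: Sgn_def sgn_real_def)
  then show ?thesis
    by blast
qed

section \<open>The maximum norm and its subgradients\<close>

lemma infnorm_cart_le_iff:
  fixes x :: "real ^ 'n"
  shows "infnorm x \<le> b \<longleftrightarrow> (\<forall>i. \<bar>x $ i\<bar> \<le> b)"
proof
  assume "\<forall>i. \<bar>x $ i\<bar> \<le> b"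
  then show "infnorm x \<le> b"
    unfolding infnorm_cart by (intro cSup_least) auto
qed (use component_le_infnorm_cart order_trans in blast)

lemma compact_infnorm_le: "compact {x :: real ^ 'n. infnorm x \<le> r}"
proof -
  have "{x :: real ^ 'n. infnorm x \<le> r} = cbox (\<chi> i. - r) (\<chi> i. r)"
    by (auto simp: infnorm_cart_le_iff mem_box_cart abs_le_iff minus_le_iff)
  then show ?thesis
    by simp
qed

text \<open>By homogeneity of the norm, testing the subgradient inequality at \<open>0\<close> and
  at twice \<open>x\<close> gives the two inequalities.\<close>

lemma subdifferential_infnorm_inner_self:
  assumes "s \<in> subdifferential infnorm x"
  shows "s \<bullet> x = infnorm x"
proof -
  have s: "infnorm y \<ge> infnorm x + s \<bullet> (y - x)" for y
    using assms by (auto simp: subdifferential_def)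
  have "infnorm (2 *\<^sub>R x) = 2 * infnorm x"
    by (simp add: infnorm_mul)
  then show ?thesis
    using s[of 0] s[of "2 *\<^sub>R x"] by (simp add: infnorm_0 scaleR_2)
qed

text \<open>Coordinate \<open>j\<close> has slack \<open>d\<close>: moving it by up to
  \<open>d\<close> in either direction does not raise the norm, which forces a zero slope.\<close>

lemma subdifferential_infnorm_support:
  fixes x :: "real ^ 'n"
  assumes s: "s \<in> subdifferential infnorm x" and j: "j \<notin> D_plus x \<union> D_minus x"
  shows "s $ j = 0"
proof -
  define d where "d = infnorm x - \<bar>x $ j\<bar>"
  have "\<bar>x $ j\<bar> \<noteq> infnorm x"
    using j by (auto simp: D_plus_def D_minus_def abs_if)
  then have d: "d > 0"
    using component_le_infnorm_cart[of x j] by (simp add: d_def)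
  have *: "s $ j * c \<le> 0" if "\<bar>c\<bar> \<le> d" for c
  proof -
    have "\<bar>(x + axis j c) $ i\<bar> \<le> infnorm x" for i
      using that component_le_infnorm_cart[of x i] by (auto simp: axis_def d_def)
    then have "infnorm (x + axis j c) \<le> infnorm x"
      by (simp add: infnorm_cart_le_iff)
    moreover have "infnorm (x + axis j c) \<ge> infnorm x + s \<bullet> axis j c"
      using s by (auto simp: subdifferential_def dest: spec[of _ "x + axis j c"])
    ultimately show ?thesis
      by (simp add: inner_axis)
  qed
  show ?thesis
    using *[of d] *[of "- d"] d by (auto simp: mult_le_0_iff zero_le_mult_iff)
qed

lemma subdifferential_infnormI:
  assumes "\<And>y. s \<bullet> y \<le> infnorm y" "s \<bullet> x = infnorm x"
  shows "s \<in> subdifferential infnorm x"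
  using assms by (auto simp: subdifferential_def inner_diff_right)

section \<open>Eigenvectors as maximisers of the total variation\<close>

lemma TV_eigenvector:
  assumes "sym (parcs G)" "eigenpair_M G \<mu> x"
  shows "TV G x = \<mu> * vol G * infnorm x"
proof -
  obtain s where "s \<in> subdifferential infnorm x" "(\<mu> * vol G) *\<^sub>R s \<in> Laplacian1 G x"
    using assms(2) by (auto simp: eigenpair_M_def)
  then show ?thesis
    using Laplacian1_inner_self[OF assms(1)] subdifferential_infnorm_inner_self
    by fastforce
qed

text \<open>At a maximiser of \<open>TV\<close> on the cube, every subgradient of \<open>TV\<close> is a multiple of a
  subgradient of the norm, so the maximum is an eigenvalue up to the factor \<open>vol\<close>.\<close>

lemma TV_le_largest_eigenvalue:
  fixes G :: "'n::finite pair_pre_digraph"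
  assumes sym: "sym (parcs G)" and verts: "pverts G = UNIV"
    and x: "eigenpair_M G \<mu> x" and max: "\<And>\<nu> y. eigenpair_M G \<nu> y \<Longrightarrow> \<nu> \<le> \<mu>"
  shows "TV G z \<le> \<mu> * vol G * infnorm z"
proof -
  let ?K = "{y :: real ^ 'n. infnorm y \<le> 1}"
  have "0 \<in> ?K"
    by (simp add: infnorm_0)
  then obtain y where y: "y \<in> ?K" "\<And>w. w \<in> ?K \<Longrightarrow> TV G w \<le> TV G y"
    using continuous_attains_sup[OF compact_infnorm_le _ continuous_on_TV] by blast
  \<comment> \<open>Homogeneity carries maximality from the cube to all vectors.\<close>
  have bound: "TV G w \<le> TV G y * infnorm w" for w
  proof (cases "w = 0")
    case True
    then show ?thesis
      using TV_scaleR[of G 0 0] by (simp add: infnorm_0)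
  next
    case False
    then have w: "infnorm w > 0"
      by (simp add: infnorm_pos_lt)
    then have "TV G ((1 / infnorm w) *\<^sub>R w) \<le> TV G y"
      by (intro y(2)) (simp add: infnorm_mul)
    then show ?thesis
      using w by (simp add: TV_scaleR divide_le_eq)
  qed
  have "TV G y \<le> \<mu> * vol G"
  \<comment> \<open>The subgradient built below divides by \<open>TV G y\<close>; when this is 0,
    the sign of \<open>\<mu> * vol G\<close> read off from \<open>x\<close> suffices.\<close>
  proof (cases "TV G y = 0")
    case True
    have "infnorm x > 0"
      using x by (simp add: eigenpair_M_def infnorm_pos_lt)
    moreover have "0 \<le> \<mu> * vol G * infnorm x"
      using TV_nonneg[of G x] TV_eigenvector[OF sym x] by simp
    ultimately show ?thesis
      using True by (simp add: zero_le_mult_iff)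
  next
    case False
    with TV_nonneg[of G y] have pos: "TV G y > 0"
      by simp
    \<comment> \<open>Dividing \<open>bound\<close> at \<open>y\<close> itself by
      \<open>TV G y\<close> leaves \<open>1 \<le> infnorm y\<close>.\<close>
    have y1: "infnorm y = 1"
      using y(1) bound[of y] pos by simp
    then have "y \<noteq> 0"
      by (auto simp: infnorm_0)
    from False have "parcs G \<noteq> {}"
      by (auto simp: TV_def)
    then obtain i j where ij: "(i, j) \<in> parcs G"
      by auto
    have vol: "vol G > 0"
      unfolding vol_def
    proof (rule sum_pos2[of _ i])
      show "0 < real (out_degree (with_proj G) i)"
        using ij by (auto simp: out_degree_def card_gt_0_iff out_arcs_def)
    qed (auto simp: verts)
    obtain u where u: "u \<in> Laplacian1 G y"
      using Laplacian1_nonempty[of G y] by blast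
    define s where "s = (1 / TV G y) *\<^sub>R u"
    have "s \<in> subdifferential infnorm y"
    proof (rule subdifferential_infnormI)
      show "s \<bullet> w \<le> infnorm w" for w
        using order_trans[OF Laplacian1_inner_le[OF sym u] bound[of w]] pos
        by (simp add: s_def field_simps)
      show "s \<bullet> y = infnorm y"
        using Laplacian1_inner_self[OF sym u] pos by (simp add: s_def y1)
    qed
    moreover have "u = (TV G y / vol G * vol G) *\<^sub>R s"
      using pos vol by (simp add: s_def)
    ultimately have "eigenpair_M G (TV G y / vol G) y"
      using u \<open>y \<noteq> 0\<close> unfolding eigenpair_M_def by blast
    from max[OF this] show ?thesis
      using vol by (simp add: divide_le_eq)
  qed
  then show ?thesis
    using bound[of z] mult_right_mono[OF _ infnorm_pos_le[of z]] by force
qed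

lemma extremal_vertex_has_extremal_neighbour:
  fixes G :: "'n::finite pair_pre_digraph"
  assumes sym: "sym (parcs G)" and loopfree: "\<And>i. (i, i) \<notin> parcs G" and verts: "pverts G = UNIV"
    and x: "eigenpair_M G \<mu> x" and max: "\<And>\<nu> y. eigenpair_M G \<nu> y \<Longrightarrow> \<nu> \<le> \<mu>"
    and i: "i \<in> D_plus x \<union> D_minus x" and k: "(i, k) \<in> parcs G"
  shows "\<exists>j\<in>D_plus x \<union> D_minus x. (i, j) \<in> parcs G"
proof (rule ccontr)
  let ?D = "D_plus x \<union> D_minus x"
  assume "\<not> (\<exists>j\<in>?D. (i, j) \<in> parcs G)"
  then have nbr: "(i, j) \<notin> parcs G" if "j \<in> ?D" for j
    using that by blast
  obtain s where s: "s \<in> subdifferential infnorm x" and u: "(\<mu> * vol G) *\<^sub>R s \<in> Laplacian1 G x"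
    using x by (auto simp: eigenpair_M_def)
  have "infnorm x > 0"
    using x by (simp add: eigenpair_M_def infnorm_pos_lt)
  then have xi: "\<bar>x $ i\<bar> = infnorm x" "x $ i \<noteq> 0"
    using i by (auto simp: D_plus_def D_minus_def)
  define y where "y = (\<chi> j. if j \<in> ?D then x $ j else x $ i)"
  define w where "w = (\<chi> j. if j = i then - x $ i else y $ j)"
  have "s \<bullet> y = s \<bullet> x"
    unfolding inner_vec_def
    by (rule sum.cong) (auto simp: y_def subdifferential_infnorm_support[OF s])
  then have "\<mu> * vol G * infnorm x \<le> TV G y"
    using Laplacian1_inner_le[OF sym u, of y] subdifferential_infnorm_inner_self[OF s] by simp
  also have "TV G y < TV G w"
  proof -
    \<comment> \<open>An arc at \<open>i\<close> ends outside \<open>?D\<close>, where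
      \<open>y\<close> equals \<open>x $ i\<close>: its difference grows from 0 to twice the modulus
      of \<open>x $ i\<close>. All other arcs keep theirs. The neighbour \<open>k\<close> makes the
      growth of the sum strict.\<close>
    have *: "\<bar>y $ a - y $ b\<bar> \<le> \<bar>w $ a - w $ b\<bar>" if "(a, b) \<in> parcs G" for a b
    proof -
      have "(b, a) \<in> parcs G"
        using that sym by (auto dest: symD)
      then have "a = i \<Longrightarrow> b \<notin> ?D" "b = i \<Longrightarrow> a \<notin> ?D"
        using that nbr by auto
      then show ?thesis
        using i that loopfree by (auto simp: w_def y_def)
    qed
    have ik: "\<bar>y $ i - y $ k\<bar> < \<bar>w $ i - w $ k\<bar>"
      using i k nbr loopfree xi by (auto simp: w_def y_def)
    have "(\<Sum>(a, b)\<in>parcs G. \<bar>y $ a - y $ b\<bar>) < (\<Sum>(a, b)\<in>parcs G. \<bar>w $ a - w $ b\<bar>)"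
    proof (rule sum_strict_mono_ex1)
      show "\<exists>e\<in>parcs G. (case e of (a, b) \<Rightarrow> \<bar>y $ a - y $ b\<bar>) < (case e of (a, b) \<Rightarrow> \<bar>w $ a - w $ b\<bar>)"
        using ik k by (intro bexI[of _ "(i, k)"]) simp_all
    qed (use * in auto)
    then show ?thesis
      by (simp add: TV_def)
  qed
  also have "TV G w \<le> \<mu> * vol G * infnorm w"
    by (rule TV_le_largest_eigenvalue[OF sym verts x max])
  also have "\<dots> \<le> \<mu> * vol G * infnorm x"
  proof (rule mult_left_mono)
    show "infnorm w \<le> infnorm x"
      unfolding infnorm_cart_le_iff using xi
      by (auto simp: w_def y_def component_le_infnorm_cart)
    have "0 \<le> \<mu> * vol G * infnorm x"
      using TV_nonneg[of G x] TV_eigenvector[OF sym x] by simp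
    then show "0 \<le> \<mu> * vol G"
      using \<open>infnorm x > 0\<close> by (simp add: zero_le_mult_iff)
  qed
  finally show False
    by simp
qed

section \<open>Counting components\<close>

text \<open>By symmetry, a vertex shares its component with its neighbours, so the disjoint
  components have at least two vertices each.\<close>

lemma (in sym_digraph) two_card_sccs_le:
  assumes fin: "finite (verts G)"
    and nbr: "\<And>u. u \<in> verts G \<Longrightarrow> \<exists>v. v \<noteq> u \<and> u \<rightarrow>\<^bsub>G\<^esub> v"
  shows "2 * card sccs \<le> card (verts G)"
proof -
  have sub: "S \<subseteq> verts G" if "S \<in> sccs_verts" for S
    using that by (rule sccs_verts_subsets)
  have "2 \<le> card S" if S: "S \<in> sccs_verts" for S
  proof -
    from S obtain u where "u \<in> verts G" and Su: "S = scc_of u"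
      by (auto simp: sccs_verts_conv_scc_of)
    with nbr obtain v where v: "v \<noteq> u" "u \<rightarrow>\<^bsub>G\<^esub> v"
      by blast
    then have "v \<in> scc_of u" "u \<in> scc_of u"
      using \<open>u \<in> verts G\<close> by (auto intro: scc_ofI_reachable' in_scc_of_self)
    then have "card {u, v} \<le> card S"
      using finite_subset[OF sub[OF S] fin] by (intro card_mono) (auto simp: Su)
    then show ?thesis
      using v by simp
  qed
  then have "(\<Sum>S\<in>sccs_verts. 2) \<le> (\<Sum>S\<in>sccs_verts. card S)"
    by (intro sum_mono)
  also have "\<dots> = card (\<Union>sccs_verts)"
    by (rule card_Union_disjoint[symmetric])
      (simp_all add: pairwise_def disjnt_def sccs_verts_disjoint finite_subset[OF sub fin])
  also have "\<dots> \<le> card (verts G)"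
    using sub by (intro card_mono[OF fin]) blast
  finally show ?thesis
    by (simp add: card_sccs_verts)
qed

theorem theorem4p10:
  fixes G :: "'n::finite pair_pre_digraph"
    and \<mu> :: real
    and x :: "real ^ 'n"
  assumes "pair_graph G"
    and "pverts G = UNIV"
    and "Digraph_Component.connected (with_proj G)"
    and "CARD('n) \<ge> 3"
    and "eigenpair_M G \<mu> x"
    and "\<And>\<nu> y. eigenpair_M G \<nu> y \<Longrightarrow> \<nu> \<le> \<mu>"
  shows "real (S' G x) \<le> (real CARD('n) - 1) / 2"
proof -
  interpret pair_graph G
    by fact
  let ?D = "D_plus x \<union> D_minus x"
  let ?H = "with_proj G \<restriction> ?D"
  have sym: "sym (parcs G)"
    using sym_arcs by (simp add: symmetric_def)
  have sc: "strongly_connected (with_proj G)"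
    using assms(3) sym_arcs by (intro symmetric_connected_imp_strongly_connected)
  show ?thesis
  \<comment> \<open>If \<open>?D\<close> is everything, counting pairs gives only n/2; instead
    connectedness gives one component, and n at least 3 makes the bound at least 1.\<close>
  proof (cases "?D = UNIV")
    case True
    then have "?H = with_proj G"
      by (simp add: induce_subgraph_def with_proj_def assms(2))
    then have "S' G x = card (pre_digraph.sccs (with_proj G))"
      by (simp add: S'_def)
    also have "\<dots> = 1"
      using sc by (simp add: strongly_connected_eq_iff)
    finally show ?thesis
      using assms(4) by simp
  next
    case False
    interpret H: sym_digraph ?H
      by (rule induced_graph_imp_graph) (auto simp: assms(2))
    have "2 * card H.sccs \<le> card (verts ?H)"
    proof (rule H.two_card_sccs_le)
      fix i assume "i \<in> verts ?H"
      then have i: "i \<in> ?D"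
        by simp
      have "UNIV \<noteq> {i}"
      proof
        assume "UNIV = {i}"
        then have "CARD('n) = card {i}"
          by (rule arg_cong)
        with assms(4) show False
          by simp
      qed
      then obtain j where "j \<noteq> i"
        by auto
      \<comment> \<open>The first arc of a path from \<open>i\<close> to another vertex gives the
        neighbour \<open>k\<close>.\<close>
      have "i \<rightarrow>\<^sup>*\<^bsub>with_proj G\<^esub> j"
        using sc by (simp add: strongly_connected_def assms(2))
      then obtain k where k: "(i, k) \<in> parcs G"
        by (rule converse_reachable_cases) (use \<open>j \<noteq> i\<close> in simp_all)
      have "\<exists>j\<in>?D. (i, j) \<in> parcs G"
        by (rule extremal_vertex_has_extremal_neighbour[OF sym _ assms(2,5) _ i k])
          (use no_loops' assms(6) in blast)+
      then obtain j where "j \<in> ?D" "(i, j) \<in> parcs G"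
        by blast
      with i have "i \<rightarrow>\<^bsub>?H\<^esub> j"
        unfolding arcs_ends_conv by (intro rev_image_eqI[of "(i, j)"]) simp_all
      moreover have "j \<noteq> i"
        using no_loops'[OF \<open>(i, j) \<in> parcs G\<close>] by simp
      ultimately show "\<exists>j. j \<noteq> i \<and> i \<rightarrow>\<^bsub>?H\<^esub> j"
        by blast
    qed simp
    \<comment> \<open>Strictness, from \<open>?D\<close> being proper, turns n into n - 1.\<close>
    also have "card (verts ?H) < CARD('n)"
      using False by (simp add: psubset_card_mono psubset_eq)
    finally show ?thesis
      by (simp add: S'_def)
  qed
qed

end
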